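(* Let $\mathbb{F}$ be a field and let $f(\overline{x},\overline{y})=\prod_{i=1}^n(x_i+y_i+\alpha_i)\in\mathbb{F}[x_1,\ldots,x_n,y_1,\ldots,y_n]$, for $\alpha_i\in\mathbb{F}$. Then for any $0\ne g\in\mathbb{F}[\overline{x},\overline{y}]$, $$\dim\mathbf{Coeff}_{\overline{x}|\overline{y}}(g\cdot f)\ge2^n.$$ In particular, all nonzero multiples of $f$ require width at least $2^n$ to be computed by an roABP in any variable order where $\overline{x}$ precedes $\overline{y}$.
   Context: For $h\in\mathbb{F}[\overline{x},\overline{y}]$, write $h=\sum_{\overline{b}}h_{\overline{b}}(\overline{x})\,\overline{y}^{\overline{b}}$ with $h_{\overline{b}}\in\mathbb{F}[\overline{x}]$; then $\mathbf{Coeff}_{\overline{x}|\overline{y}}(h)=\{h_{\overline{b}}\}_{\overline{b}}$, and $\dim\mathbf{Coeff}_{\overline{x}|\overline{y}}(h)$ is the dimension of its $\mathbb{F}$-linear span. A width-$r$ read-once oblivious algebraic branching program (roABP) on $N$ variables in variable order $v_1<\cdots<v_N$ is a directed acyclic graph with vertex layers $V_0=\{s\},V_1,\ldots,V_N=\{t\}$, $|V_i|\le r$, edges only from $V_{i-1}$ to $V_i$, each edge from $V_{i-1}$ to $V_i$ labelled by a univariate polynomial in $v_i$; it computes the sum over all $s$–$t$ paths of the product of edge labels. "$\overline{x}$ precedes $\overline{y}$" means every $x_i$ comes before every $y_j$. *)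

theory Defs
  imports Complex_Main "HOL-Library.Poly_Mapping" "Graph_Theory.Digraph" "Graph_Theory.Arc_Walk"
begin

text \<open>
  A polynomial is a finitely supported map from monomials (finitely supported exponent vectors)
  to coefficients; the ring structure is the convolution product of \<^theory>\<open>HOL-Library.Poly_Mapping\<close>.
\<close>

type_synonym ('v, 'a) mpoly = "('v \<Rightarrow>\<^sub>0 nat) \<Rightarrow>\<^sub>0 'a"

definition const_mpoly :: "'a::zero \<Rightarrow> ('v, 'a) mpoly" where
  "const_mpoly c = Poly_Mapping.single 0 c"

definition var_mpoly :: "'v \<Rightarrow> ('v, 'a::zero_neq_one) mpoly" where
  "var_mpoly v = Poly_Mapping.single (Poly_Mapping.single v 1) 1"

definition polys_in :: "'v set \<Rightarrow> ('v, 'a::zero) mpoly set" where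
  "polys_in S = {p. \<forall>m \<in> Poly_Mapping.keys p. Poly_Mapping.keys m \<subseteq> S}"

definition scale_mpoly :: "'a::comm_semiring_1 \<Rightarrow> ('v, 'a) mpoly \<Rightarrow> ('v, 'a) mpoly" where
  "scale_mpoly c p = const_mpoly c * p"

lemma vector_space_mpoly: "vector_space (scale_mpoly :: 'a::field \<Rightarrow> ('v, 'a) mpoly \<Rightarrow> _)"
  by unfold_locales
    (simp_all add: scale_mpoly_def const_mpoly_def algebra_simps single_add mult_single
      flip: mult.assoc)

text \<open>
  \<open>restrict_exp S m\<close> is the exponent vector of the largest divisor of the monomial \<open>m\<close> that only
  involves variables from \<open>S\<close>.
\<close>

definition restrict_exp :: "'v set \<Rightarrow> ('v \<Rightarrow>\<^sub>0 nat) \<Rightarrow> ('v \<Rightarrow>\<^sub>0 nat)" where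
  "restrict_exp S m =
    (\<Sum>v \<in> Poly_Mapping.keys m \<inter> S. Poly_Mapping.single v (Poly_Mapping.lookup m v))"

text \<open>
  For disjoint \<open>X\<close>, \<open>Y\<close> and a polynomial \<open>h\<close> in the variables \<open>X \<union> Y\<close>, this is the coefficient
  (a polynomial in \<open>X\<close>) of the \<open>Y\<close>-monomial with exponent vector \<open>b\<close>;
  see \<open>coeff_xy_decomposition\<close> and \<open>coeff_xy_polys_in\<close> below.
\<close>

definition coeff_xy ::
    "'v set \<Rightarrow> 'v set \<Rightarrow> ('v, 'a::comm_monoid_add) mpoly \<Rightarrow> ('v \<Rightarrow>\<^sub>0 nat) \<Rightarrow> ('v, 'a) mpoly" where
  "coeff_xy X Y h b =
    (\<Sum>m \<in> {m \<in> Poly_Mapping.keys h. restrict_exp Y m = b}.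
       Poly_Mapping.single (restrict_exp X m) (Poly_Mapping.lookup h m))"

definition Coeff :: "'v set \<Rightarrow> 'v set \<Rightarrow> ('v, 'a::comm_monoid_add) mpoly \<Rightarrow> ('v, 'a) mpoly set" where
  "Coeff X Y h = {coeff_xy X Y h b | b. Poly_Mapping.keys b \<subseteq> Y}"

lemma lookup_restrict_exp:
  "Poly_Mapping.lookup (restrict_exp S m) v = (if v \<in> S then Poly_Mapping.lookup m v else 0)"
  by (auto simp: restrict_exp_def lookup_sum lookup_single when_def in_keys_iff sum.delta)

lemma keys_restrict_exp: "Poly_Mapping.keys (restrict_exp S m) = Poly_Mapping.keys m \<inter> S"
  by (auto simp: in_keys_iff lookup_restrict_exp split: if_splits)

lemma restrict_exp_split:
  assumes "X \<inter> Y = {}" "Poly_Mapping.keys m \<subseteq> X \<union> Y"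
  shows "restrict_exp X m + restrict_exp Y m = m"
  using assms by (intro poly_mapping_eqI)
    (auto simp: lookup_add lookup_restrict_exp in_keys_iff subset_iff disjoint_iff)

lemma coeff_xy_polys_in: "coeff_xy X Y h b \<in> polys_in X"
proof -
  have "Poly_Mapping.keys (coeff_xy X Y h b) \<subseteq>
      (\<Union>m. Poly_Mapping.keys (Poly_Mapping.single (restrict_exp X m) (Poly_Mapping.lookup h m)))"
    unfolding coeff_xy_def by (rule order_trans[OF keys_sum]) auto
  then show ?thesis
    by (fastforce simp: polys_in_def keys_restrict_exp split: if_splits)
qed

lemma coeff_xy_decomposition:
  fixes h :: "('v, 'a::comm_semiring_1) mpoly"
  assumes "X \<inter> Y = {}" "h \<in> polys_in (X \<union> Y)"
  shows "h = (\<Sum>b \<in> restrict_exp Y ` Poly_Mapping.keys h.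
                coeff_xy X Y h b * Poly_Mapping.single b 1)"
proof -
  have "(\<Sum>b \<in> restrict_exp Y ` Poly_Mapping.keys h. coeff_xy X Y h b * Poly_Mapping.single b 1) =
      (\<Sum>b \<in> restrict_exp Y ` Poly_Mapping.keys h. \<Sum>m \<in> {m \<in> Poly_Mapping.keys h. restrict_exp Y m = b}.
         Poly_Mapping.single m (Poly_Mapping.lookup h m))"
    unfolding coeff_xy_def sum_distrib_right
  proof (intro sum.cong refl)
    fix b m
    assume m: "m \<in> {m \<in> Poly_Mapping.keys h. restrict_exp Y m = b}"
    with assms have "restrict_exp X m + b = m"
      using restrict_exp_split[of X Y m] by (auto simp: polys_in_def)
    then show "Poly_Mapping.single (restrict_exp X m) (Poly_Mapping.lookup h m) *
        Poly_Mapping.single b 1 = Poly_Mapping.single m (Poly_Mapping.lookup h m)"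
      by (simp add: mult_single)
  qed
  also have "\<dots> = (\<Sum>m \<in> Poly_Mapping.keys h. Poly_Mapping.single m (Poly_Mapping.lookup h m))"
    by (rule sum.group) auto
  also have "\<dots> = h"
    by (intro poly_mapping_eqI)
      (auto simp: lookup_sum lookup_single when_def in_keys_iff sum.delta)
  finally show ?thesis ..
qed

text \<open>
  The list \<open>vs\<close> is the variable order and \<open>V 0, \<dots>, V (length vs)\<close> are the vertex layers. As \<open>vs\<close> is
  indexed from 0, the edges from layer \<open>i\<close> to layer \<open>i + 1\<close> carry polynomials in the single
  variable \<open>vs ! i\<close>. Acyclicity follows from the layering; parallel edges are allowed.
\<close>

locale roABP = fin_digraph G
  for G :: "('u, 'e) pre_digraph" (structure) +
  fixes vs :: "'v list"
    and V :: "nat \<Rightarrow> 'u set"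
    and s t :: 'u
    and lab :: "'e \<Rightarrow> ('v, 'a::comm_semiring_1) mpoly"
    and r :: nat
  assumes distinct_vs: "distinct vs"
    and verts_layers: "verts G = (\<Union>i \<le> length vs. V i)"
    and layers_disjoint:
      "\<lbrakk>i \<le> length vs; j \<le> length vs; i \<noteq> j\<rbrakk> \<Longrightarrow> V i \<inter> V j = {}"
    and source: "V 0 = {s}"
    and sink: "V (length vs) = {t}"
    and width: "i \<le> length vs \<Longrightarrow> card (V i) \<le> r"
    and arcs_layers: "e \<in> arcs G \<Longrightarrow>
      \<exists>i < length vs. tail G e \<in> V i \<and> head G e \<in> V (Suc i) \<and> lab e \<in> polys_in {vs ! i}"

definition abp_poly ::
    "('u, 'e) pre_digraph \<Rightarrow> 'u \<Rightarrow> 'u \<Rightarrow> ('e \<Rightarrow> ('v, 'a::comm_semiring_1) mpoly) \<Rightarrow> ('v, 'a) mpoly" where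
  "abp_poly G s t lab = (\<Sum>p \<in> {p. pre_digraph.apath G s p t}. \<Prod>e \<leftarrow> p. lab e)"

datatype xyvar = X nat | Y nat

definition xvars :: "nat \<Rightarrow> xyvar set" where
  "xvars n = X ` {1..n}"

definition yvars :: "nat \<Rightarrow> xyvar set" where
  "yvars n = Y ` {1..n}"

definition precedes :: "'v list \<Rightarrow> 'v set \<Rightarrow> 'v set \<Rightarrow> bool" where
  "precedes vs A B \<longleftrightarrow>
    (\<forall>i < length vs. \<forall>j < length vs. vs ! i \<in> A \<longrightarrow> vs ! j \<in> B \<longrightarrow> i < j)"

definition f_poly :: "nat \<Rightarrow> (nat \<Rightarrow> 'a::comm_semiring_1) \<Rightarrow> (xyvar, 'a) mpoly" where
  "f_poly n \<alpha> = (\<Prod>i = 1..n. var_mpoly (X i) + var_mpoly (Y i) + const_mpoly (\<alpha> i))"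

end

theory Submission
  imports Defs
begin

text \<open>
  Write \<open>f = f' (x + y + \<alpha>\<^sub>n)\<close> with \<open>x = x\<^sub>n\<close>, \<open>y = y\<^sub>n\<close>. In the part of \<open>g\<close> of top total degree in
  \<open>x, y\<close>, let \<open>(a0, c0)\<close> and \<open>(a1, c1)\<close> be the exponents of \<open>(x, y)\<close> with the largest and the smallest
  power of \<open>x\<close>. In the coefficient matrix of \<open>g f\<close>, whose rows and columns are indexed by the monomials
  in the \<open>x\<^sub>i\<close> and in the \<open>y\<^sub>i\<close>, the blocks with \<open>x\<close>-exponents \<open>a1, a0 + 1\<close> and \<open>y\<close>-exponents
  \<open>c1 + 1, c0\<close> form a block triangular matrix whose diagonal blocks are the coefficient
  matrices of nonzero multiples of \<open>f'\<close>. Hence the rank at least doubles with each factor. For the roABP bound, cutting the program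
  between the \<open>x\<close>-variables and the \<open>y\<close>-variables writes \<open>g f\<close> as a sum of at most \<open>r\<close> products
  \<open>P(x) Q(y)\<close>, so the coefficients of \<open>g f\<close> lie in the span of the polynomials \<open>P\<close>.
\<close>

abbreviation (input) "lookup \<equiv> Poly_Mapping.lookup"
abbreviation (input) "keys \<equiv> Poly_Mapping.keys"

section \<open>Coefficients of polynomials\<close>

lemma polys_inD: "p \<in> polys_in S \<Longrightarrow> lookup p m \<noteq> 0 \<Longrightarrow> keys m \<subseteq> S"
  by (auto simp: polys_in_def in_keys_iff)

lemma polys_in_0: "0 \<in> polys_in S"
  by (simp add: polys_in_def)

lemma polys_in_1: "1 \<in> polys_in S"
  by (auto simp: polys_in_def)

lemma polys_in_mono: "p \<in> polys_in S \<Longrightarrow> S \<subseteq> T \<Longrightarrow> p \<in> polys_in T"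
  by (auto simp: polys_in_def)

lemma polys_in_single: "keys m \<subseteq> S \<Longrightarrow> Poly_Mapping.single m c \<in> polys_in S"
  by (auto simp: polys_in_def)

lemma polys_in_add: "p \<in> polys_in S \<Longrightarrow> q \<in> polys_in S \<Longrightarrow> p + q \<in> polys_in S"
  using Poly_Mapping.keys_add[of p q] by (fastforce simp: polys_in_def)

lemma polys_in_sum: "(\<And>i. i \<in> I \<Longrightarrow> p i \<in> polys_in S) \<Longrightarrow> (\<Sum>i\<in>I. p i) \<in> polys_in S"
  by (induction I rule: infinite_finite_induct) (auto intro: polys_in_add polys_in_0)

lemma keys_add_nat:
  fixes a b :: "'v \<Rightarrow>\<^sub>0 nat"
  shows "keys (a + b) = keys a \<union> keys b"
  by (auto simp: in_keys_iff lookup_add)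

lemma polys_in_mult:
  assumes "p \<in> polys_in S" "q \<in> polys_in S"
  shows "p * q \<in> polys_in S"
  using keys_mult[of p q] assms by (fastforce simp: polys_in_def keys_add_nat)

lemma polys_in_prod: "(\<And>i. i \<in> I \<Longrightarrow> p i \<in> polys_in S) \<Longrightarrow> (\<Prod>i\<in>I. p i) \<in> polys_in S"
  by (induction I rule: infinite_finite_induct) (auto intro: polys_in_mult polys_in_1)

section \<open>Coefficients of products and of \<open>coeff_xy\<close>\<close>

lemma sum_single_lookup: "(\<Sum>m\<in>keys p. Poly_Mapping.single m (lookup p m)) = p"
  by (intro poly_mapping_eqI) (auto simp: lookup_sum lookup_single when_def in_keys_iff sum.delta)

lemma lookup_mult_keys:
  "lookup (p * q) k =
    (\<Sum>l\<in>keys p. \<Sum>m\<in>keys q. lookup p l * lookup q m when l + m = k)"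
proof -
  have "p * q = (\<Sum>l\<in>keys p. Poly_Mapping.single l (lookup p l)) *
      (\<Sum>m\<in>keys q. Poly_Mapping.single m (lookup q m))"
    by (simp only: sum_single_lookup)
  also have "\<dots> = (\<Sum>l\<in>keys p. \<Sum>m\<in>keys q.
      Poly_Mapping.single (l + m) (lookup p l * lookup q m))"
    by (simp add: sum_product mult_single)
  finally show ?thesis
    by (simp add: lookup_sum lookup_single)
qed

lemma restrict_exp_add:
  assumes "keys a \<subseteq> S" "keys b \<inter> S = {}"
  shows "restrict_exp S (a + b) = a"
proof (rule poly_mapping_eqI)
  fix v
  show "lookup (restrict_exp S (a + b)) v = lookup a v"
  proof (cases "v \<in> S")
    case True
    then have "v \<notin> keys b"
      using assms by auto
    with True show ?thesis
      by (simp add: lookup_restrict_exp lookup_add in_keys_iff)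
  next
    case False
    then have "v \<notin> keys a"
      using assms by auto
    with False show ?thesis
      by (simp add: lookup_restrict_exp in_keys_iff)
  qed
qed

text \<open>A monomial over two disjoint variable sets splits in only one way, so a single term of
  the convolution survives.\<close>

lemma lookup_mult_disjoint:
  assumes "p \<in> polys_in A" "q \<in> polys_in B" "A \<inter> B = {}"
    and "keys a \<subseteq> A" "keys b \<subseteq> B"
  shows "lookup (p * q) (a + b) = lookup p a * lookup q b"
proof -
  have split: "l + m = a + b \<longleftrightarrow> l = a \<and> m = b"
    if "l \<in> keys p" "m \<in> keys q" for l m
  proof
    assume eq: "l + m = a + b"
    have *: "keys l \<subseteq> A" "keys m \<subseteq> B"
      using that assms by (auto simp: polys_in_def)
    have "restrict_exp A (l + m) = l" "restrict_exp A (a + b) = a"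
      using * assms(3-5) by (auto intro!: restrict_exp_add)
    with eq show "l = a \<and> m = b"
      by auto
  qed auto
  have "lookup (p * q) (a + b) = (\<Sum>l\<in>keys p. \<Sum>m\<in>keys q.
      if l = a then if m = b then lookup p a * lookup q b else 0 else 0)"
    unfolding lookup_mult_keys by (intro sum.cong refl) (auto simp: split when_def)
  also have "\<dots> = (\<Sum>l\<in>keys p. if l = a then \<Sum>m\<in>keys q.
      if m = b then lookup p a * lookup q b else 0 else 0)"
    by (intro sum.cong) auto
  also have "\<dots> = lookup p a * lookup q b"
    by (auto simp: sum.delta in_keys_iff)
  finally show ?thesis .
qed

lemma lookup_mult_single:
  fixes m :: "'v \<Rightarrow>\<^sub>0 nat"
  shows "lookup (p * Poly_Mapping.single e c) (m + e) = lookup p m * c"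
proof -
  have "lookup (p * Poly_Mapping.single e c) (m + e) =
      (\<Sum>l\<in>keys p. if l = m then lookup p m * c else 0)"
    unfolding lookup_mult_keys by (intro sum.cong refl) (auto simp: when_def)
  then show ?thesis
    by (auto simp: sum.delta in_keys_iff)
qed

text \<open>The monomial \<open>e\<close> does not divide \<open>k\<close>. This supplies the zero
  cases of the recurrence for \<open>H\<close> in the induction on \<open>n\<close>.\<close>

lemma lookup_mult_single_eq_0:
  fixes k :: "'v \<Rightarrow>\<^sub>0 nat"
  assumes "lookup k v < lookup e v"
  shows "lookup (p * Poly_Mapping.single e c) k = 0"
proof -
  have "l + e \<noteq> k" for l
    using assms by (auto simp: lookup_add)
  then show ?thesis
    unfolding lookup_mult_keys by (auto intro!: sum.neutral simp: when_def)
qed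

text \<open>This turns coefficient polynomials into columns of a matrix: rows are monomials over
  \<open>A\<close>, columns monomials over \<open>B\<close>, and the entry at \<open>a\<close>,
  \<open>b\<close> is the coefficient of \<open>a + b\<close>.\<close>

lemma lookup_coeff_xy:
  assumes "A \<inter> B = {}" "h \<in> polys_in (A \<union> B)"
    and "keys a \<subseteq> A" "keys b \<subseteq> B"
  shows "lookup (coeff_xy A B h b) a = lookup h (a + b)"
proof -
  have eq: "restrict_exp B m = b \<and> restrict_exp A m = a \<longleftrightarrow> m = a + b"
    if "m \<in> keys h" for m
  proof
    assume "restrict_exp B m = b \<and> restrict_exp A m = a"
    with restrict_exp_split[of A B m] that assms show "m = a + b"
      by (auto simp: polys_in_def)
  next
    assume "m = a + b"
    then show "restrict_exp B m = b \<and> restrict_exp A m = a"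
      using assms(1,3,4) restrict_exp_add[of b B a] restrict_exp_add[of a A b]
      by (auto simp: add.commute)
  qed
  have "lookup (coeff_xy A B h b) a =
      (\<Sum>m\<in>{m \<in> keys h. restrict_exp B m = b}.
        if restrict_exp A m = a then lookup h m else 0)"
    by (simp add: coeff_xy_def lookup_sum lookup_single when_def)
  also have "\<dots> = (\<Sum>m\<in>keys h. if m = a + b then lookup h m else 0)"
    by (rule sum.mono_neutral_cong_left) (auto simp: eq[symmetric])
  also have "\<dots> = lookup h (a + b)"
    by (auto simp: sum.delta' in_keys_iff)
  finally show ?thesis .
qed

text \<open>Taking a coefficient with respect to \<open>B\<close> is linear over polynomials in
  \<open>A\<close>, so a factor free of \<open>B\<close> can be pulled out. The induction uses this
  with \<open>B\<close> the newest pair of variables.\<close>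

lemma lookup_coeff_xy_mult:
  fixes g f :: "('v, 'a::comm_semiring_1) mpoly"
  assumes AB: "A \<inter> B = {}" and g: "g \<in> polys_in (A \<union> B)" and f: "f \<in> polys_in A"
    and a: "keys a \<subseteq> A" and b: "keys b \<subseteq> B"
  shows "lookup (g * f) (a + b) = lookup (coeff_xy A B g b * f) a"
proof -
  let ?E = "restrict_exp B ` keys g"
  have "g * f = (\<Sum>e\<in>?E. (coeff_xy A B g e * f) * Poly_Mapping.single e 1)"
    by (subst coeff_xy_decomposition[OF AB g]) (simp add: sum_distrib_left mult_ac)
  then have "lookup (g * f) (a + b) =
      (\<Sum>e\<in>?E. lookup ((coeff_xy A B g e * f) * Poly_Mapping.single e 1) (a + b))"
    by (simp add: lookup_sum)
  also have "\<dots> = (\<Sum>e\<in>?E. lookup (coeff_xy A B g e * f) a * lookup (Poly_Mapping.single e 1) b)"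
    by (intro sum.cong refl lookup_mult_disjoint[OF _ _ AB a b] polys_in_mult coeff_xy_polys_in f
        polys_in_single) (auto simp: keys_restrict_exp)
  also have "\<dots> = (\<Sum>e\<in>?E. if e = b then lookup (coeff_xy A B g b * f) a else 0)"
    by (intro sum.cong) (auto simp: lookup_single when_def)
  also have "\<dots> = lookup (coeff_xy A B g b * f) a"
  \<comment> \<open>If \<open>b\<close> is not the \<open>B\<close>-part of any monomial of
    \<open>g\<close>, the sum has no matching index, and the coefficient of \<open>b\<close> is 0 as
    well.\<close>
  proof (cases "b \<in> ?E")
    case False
    then have "{m \<in> keys g. restrict_exp B m = b} = {}"
      by auto
    then have "coeff_xy A B g b = 0"
      unfolding coeff_xy_def by (simp only: sum.empty)
    with False show ?thesis
      by auto
  qed (simp add: sum.delta)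
  finally show ?thesis .
qed

section \<open>Independent coefficients of multiples\<close>

text \<open>Take the points of \<open>K\<close> of maximal sum and among them the two ends, with
  largest and smallest first entry. The two ends may coincide.\<close>

lemma exists_extreme_pairs:
  fixes K :: "(nat \<times> nat) set"
  assumes "finite K" "K \<noteq> {}"
  obtains a0 c0 a1 c1 where "(a0, c0) \<in> K" "(a1, c1) \<in> K" "a0 + c0 = a1 + c1" "a1 \<le> a0"
    and "\<And>a c. (a, c) \<in> K \<Longrightarrow> a + c \<le> a0 + c0"
    and "\<And>a c. (a, c) \<in> K \<Longrightarrow> a + c = a0 + c0 \<Longrightarrow> a1 \<le> a \<and> a \<le> a0"
proof -
  define D where "D = Max ((\<lambda>(a, c). a + c) ` K)"
  define T where "T = {a. \<exists>c. (a, c) \<in> K \<and> a + c = D}"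
  have le: "a + c \<le> D" if "(a, c) \<in> K" for a c
    unfolding D_def using that assms by (auto intro!: Max_ge)
  have "D \<in> (\<lambda>(a, c). a + c) ` K"
    unfolding D_def using assms by (intro Max_in) auto
  then have "T \<noteq> {}"
    by (auto simp: T_def)
  have "T \<subseteq> fst ` K"
    by (force simp: T_def)
  then have "finite T"
    using assms(1) finite_subset by blast
  obtain c0 where c0: "(Max T, c0) \<in> K" "Max T + c0 = D"
    using Max_in[OF \<open>finite T\<close> \<open>T \<noteq> {}\<close>] unfolding T_def by blast
  obtain c1 where c1: "(Min T, c1) \<in> K" "Min T + c1 = D"
    using Min_in[OF \<open>finite T\<close> \<open>T \<noteq> {}\<close>] unfolding T_def by blast
  show thesis
  proof (rule that[OF c0(1) c1(1)])
    show "Min T \<le> Max T"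
      using \<open>finite T\<close> \<open>T \<noteq> {}\<close> by (meson Max_ge Min_in)
    fix a c assume "(a, c) \<in> K"
    then show "a + c \<le> Max T + c0"
      using le c0 by simp
    assume "a + c = Max T + c0"
    with \<open>(a, c) \<in> K\<close> c0 have "a \<in> T"
      by (auto simp: T_def)
    with \<open>finite T\<close> show "Min T \<le> a \<and> a \<le> Max T"
      by auto
  qed (use c0 c1 in auto)
qed

section \<open>Doubling of the rank with each factor of f\<close>

lemma f_poly_Suc:
  "f_poly (Suc n) \<alpha> =
    f_poly n \<alpha> * (var_mpoly (X (Suc n)) + var_mpoly (Y (Suc n)) + const_mpoly (\<alpha> (Suc n)))"
  by (simp add: f_poly_def)

lemma f_poly_polys_in: "f_poly n \<alpha> \<in> polys_in (xvars n \<union> yvars n)"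
  unfolding f_poly_def var_mpoly_def const_mpoly_def
  by (intro polys_in_prod polys_in_add polys_in_single) (auto simp: xvars_def yvars_def)

lemma xvars_Suc: "xvars (Suc n) = insert (X (Suc n)) (xvars n)"
  by (auto simp: xvars_def atLeastAtMostSuc_conv)

lemma yvars_Suc: "yvars (Suc n) = insert (Y (Suc n)) (yvars n)"
  by (auto simp: yvars_def atLeastAtMostSuc_conv)

lemma xvars_yvars_disjoint: "xvars n \<inter> yvars n = {}"
  by (auto simp: xvars_def yvars_def)

text \<open>The set \<open>B\<close> names linearly independent columns of the coefficient matrix.
  Explicit columns, rather than a dimension, let the induction assemble blocks; \<open>g\<close> is
  general because the hypothesis is applied to two of its coefficients.\<close>

lemma exists_independent_coeffs:
  fixes g :: "(xyvar, 'a::field) mpoly"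
  assumes "g \<in> polys_in (xvars n \<union> yvars n)" "g \<noteq> 0"
  shows "\<exists>B. finite B \<and> card B = 2 ^ n \<and> (\<forall>b\<in>B. keys b \<subseteq> yvars n) \<and>
    (\<forall>u. (\<forall>a. keys a \<subseteq> xvars n \<longrightarrow> (\<Sum>b\<in>B. u b * lookup (g * f_poly n \<alpha>) (a + b)) = 0)
      \<longrightarrow> (\<forall>b\<in>B. u b = 0))"
  using assms
proof (induction n arbitrary: g)
  case 0
  then have "\<forall>m. lookup g m \<noteq> 0 \<longrightarrow> m = 0"
    using polys_inD[of g "{}"] by (auto simp: xvars_def yvars_def)
  with \<open>g \<noteq> 0\<close> have "lookup g 0 \<noteq> 0"
    by (metis lookup_zero poly_mapping_eqI)
  then show ?case
    by (intro exI[of _ "{0}"]) (auto simp: f_poly_def dest!: spec[of _ 0])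
next
  case (Suc n)
  let ?x = "X (Suc n)" and ?y = "Y (Suc n)"
  \<comment> \<open>\<open>Z\<close> holds the old variables and \<open>W\<close> the new pair;
    \<open>E a c\<close> is the exponent of the monomial with powers \<open>a\<close> of
    \<open>?x\<close> and \<open>c\<close> of \<open>?y\<close>, and \<open>g' a c\<close> is its
    coefficient in \<open>g\<close>.\<close>
  define Z where "Z = xvars n \<union> yvars n"
  define W where "W = {?x, ?y}"
  define E where "E a c = Poly_Mapping.single ?x a + Poly_Mapping.single ?y c" for a c :: nat
  define g' where "g' a c = coeff_xy Z W g (E a c)" for a c
  let ?f = "f_poly n \<alpha>"
  define h where "h = g * f_poly (Suc n) \<alpha>"
  have ZW: "Z \<inter> W = {}"
    by (auto simp: Z_def W_def xvars_def yvars_def)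
  have g: "g \<in> polys_in (Z \<union> W)"
    using Suc.prems(1) by (rule polys_in_mono) (auto simp: Z_def W_def xvars_Suc yvars_Suc)
  have keys_E: "keys (E a c) \<subseteq> W" for a c
    by (auto simp: E_def W_def keys_add_nat)
  have lookup_E: "lookup (E a c) ?x = a" "lookup (E a c) ?y = c" for a c
    by (simp_all add: E_def lookup_add lookup_single when_def)
  have E_surj: "e = E (lookup e ?x) (lookup e ?y)" if "keys e \<subseteq> W" for e
    using that by (auto intro!: poly_mapping_eqI
      simp: E_def W_def lookup_add lookup_single when_def in_keys_iff)
  have E_Suc: "E (Suc a) c = E a c + Poly_Mapping.single ?x 1"
    "E a (Suc c) = E a c + Poly_Mapping.single ?y 1" for a c
    by (auto intro!: poly_mapping_eqI simp: E_def lookup_add lookup_single when_def)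

  \<comment> \<open>\<open>G a c\<close> and \<open>H a c\<close> list the coefficients over the old
    variables in the block at exponents \<open>(a, c)\<close>, before and after multiplication by
    the new linear factor.\<close>
  define G where "G a c m = lookup (g' a c * ?f) m" for a c m
  define H where "H a c m = lookup h (m + E a c)" for a c m
  have G: "lookup (g * ?f) (m + E a c) = G a c m" if "keys m \<subseteq> Z" for a c m
    unfolding G_def g'_def using f_poly_polys_in[of n \<alpha>] that keys_E
    by (intro lookup_coeff_xy_mult[OF ZW g]) (auto simp: Z_def)
  \<comment> \<open>The terms of the new factor shift \<open>a\<close> by one, shift
    \<open>c\<close> by one, or scale by the constant; a shift contributes 0 where the exponent is
    already 0.\<close>
  have H: "H a c m = (case a of 0 \<Rightarrow> 0 | Suc a' \<Rightarrow> G a' c m) +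
      (case c of 0 \<Rightarrow> 0 | Suc c' \<Rightarrow> G a c' m) + G a c m * \<alpha> (Suc n)"
    if m: "keys m \<subseteq> Z" for a c m
  proof -
    have m0: "lookup m ?x = 0" "lookup m ?y = 0"
      using m ZW by (auto simp: W_def in_keys_iff subset_iff disjoint_iff)
    have "h = g * ?f * Poly_Mapping.single (Poly_Mapping.single ?x 1) 1 +
        g * ?f * Poly_Mapping.single (Poly_Mapping.single ?y 1) 1 +
        g * ?f * Poly_Mapping.single 0 (\<alpha> (Suc n))"
      by (simp add: h_def f_poly_Suc var_mpoly_def const_mpoly_def algebra_simps)
    moreover have "lookup (g * ?f * Poly_Mapping.single (Poly_Mapping.single ?x 1) 1) (m + E a c) =
        (case a of 0 \<Rightarrow> 0 | Suc a' \<Rightarrow> G a' c m)"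
    proof (cases a)
      case 0
      then show ?thesis
        by (auto intro!: lookup_mult_single_eq_0[where v = ?x] simp: lookup_add lookup_E m0)
    next
      case (Suc a')
      then show ?thesis
        using lookup_mult_single[of "g * ?f" "Poly_Mapping.single ?x 1" 1 "m + E a' c"] G[OF m]
        by (simp add: E_Suc ac_simps)
    qed
    moreover have "lookup (g * ?f * Poly_Mapping.single (Poly_Mapping.single ?y 1) 1) (m + E a c) =
        (case c of 0 \<Rightarrow> 0 | Suc c' \<Rightarrow> G a c' m)"
    proof (cases c)
      case 0
      then show ?thesis
        by (auto intro!: lookup_mult_single_eq_0[where v = ?y] simp: lookup_add lookup_E m0)
    next
      case (Suc c')
      then show ?thesis
        using lookup_mult_single[of "g * ?f" "Poly_Mapping.single ?y 1" 1 "m + E a c'"] G[OF m]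
        by (simp add: E_Suc ac_simps)
    qed
    moreover have "lookup (g * ?f * Poly_Mapping.single 0 (\<alpha> (Suc n))) (m + E a c) =
        G a c m * \<alpha> (Suc n)"
      using lookup_mult_single[of "g * ?f" 0 "\<alpha> (Suc n)" "m + E a c"] G[OF m] by simp
    ultimately show ?thesis
      by (simp add: H_def lookup_add)
  qed

  define K where "K = {(a, c). g' a c \<noteq> 0}"
  have "K \<subseteq> (\<lambda>e. (lookup e ?x, lookup e ?y)) ` restrict_exp W ` keys g"
  proof clarify
    fix a c assume "(a, c) \<in> K"
    then have "coeff_xy Z W g (E a c) \<noteq> 0"
      by (simp add: K_def g'_def)
    then have "E a c \<in> restrict_exp W ` keys g"
      unfolding coeff_xy_def by (auto elim!: sum.not_neutral_contains_not_neutral intro: image_eqI[OF sym])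
    then show "(a, c) \<in> (\<lambda>e. (lookup e ?x, lookup e ?y)) ` restrict_exp W ` keys g"
      by (rule rev_image_eqI) (simp add: lookup_E)
  qed
  then have "finite K"
    by (rule finite_subset) auto
  have "K \<noteq> {}"
  proof -
    obtain m where m: "lookup g m \<noteq> 0"
      using \<open>g \<noteq> 0\<close> by (metis lookup_zero poly_mapping_eqI)
    then have "keys m \<subseteq> Z \<union> W"
      using g polys_inD by blast
    then have "lookup (coeff_xy Z W g (restrict_exp W m)) (restrict_exp Z m) \<noteq> 0"
      using m restrict_exp_split[OF ZW]
      by (subst lookup_coeff_xy[OF ZW g]) (auto simp: keys_restrict_exp)
    then have "coeff_xy Z W g (restrict_exp W m) \<noteq> 0"
      by auto
    moreover have "restrict_exp W m = E (lookup (restrict_exp W m) ?x) (lookup (restrict_exp W m) ?y)"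
      by (rule E_surj) (simp add: keys_restrict_exp)
    ultimately have "g' (lookup (restrict_exp W m) ?x) (lookup (restrict_exp W m) ?y) \<noteq> 0"
      unfolding g'_def by argo
    then show ?thesis
      by (auto simp: K_def)
  qed
  obtain a0 c0 a1 c1 where K: "(a0, c0) \<in> K" "(a1, c1) \<in> K" "a0 + c0 = a1 + c1" "a1 \<le> a0"
    and top: "\<And>a c. (a, c) \<in> K \<Longrightarrow> a + c \<le> a0 + c0"
    and extreme: "\<And>a c. (a, c) \<in> K \<Longrightarrow> a + c = a0 + c0 \<Longrightarrow> a1 \<le> a \<and> a \<le> a0"
    using exists_extreme_pairs[OF \<open>finite K\<close> \<open>K \<noteq> {}\<close>] by metis
  \<comment> \<open>These exponents lie outside \<open>K\<close>: either above the top degree, or on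
    the top degree line beyond one of its ends.\<close>
  have G0: "G a c m = 0" if "a + c > a0 + c0 \<or> a + c = a0 + c0 \<and> (a < a1 \<or> a0 < a)" for a c m
  proof -
    have "(a, c) \<notin> K"
      using top[of a c] extreme[of a c] that by auto
    then show ?thesis
      by (simp add: G_def K_def)
  qed
  \<comment> \<open>At \<open>(Suc a0, c0)\<close> the other neighbours lie past the right end of
    the top line or above it; \<open>(a1, Suc c1)\<close> is symmetric at the left end. At
    \<open>(Suc a0, Suc c1)\<close> all terms lie above the top degree, since
    \<open>c0 \<le> c1\<close>.\<close>
  have H00: "H (Suc a0) c0 m = G a0 c0 m" if "keys m \<subseteq> Z" for m
    unfolding H[OF that] by (auto simp: G0 split: nat.split)
  have H11: "H a1 (Suc c1) m = G a1 c1 m" if "keys m \<subseteq> Z" for m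
    unfolding H[OF that] using K by (auto simp: G0 split: nat.split)
  have H01: "H (Suc a0) (Suc c1) m = 0" if "keys m \<subseteq> Z" for m
    unfolding H[OF that] using K by (auto simp: G0)

  have g'_in: "g' a c \<in> polys_in (xvars n \<union> yvars n)" for a c
    unfolding g'_def Z_def by (rule coeff_xy_polys_in)
  have "g' a0 c0 \<noteq> 0" "g' a1 c1 \<noteq> 0"
    using K by (auto simp: K_def)
  obtain B0 where B0: "finite B0" "card B0 = 2 ^ n" "\<forall>b\<in>B0. keys b \<subseteq> yvars n"
    and ind0: "\<forall>u. (\<forall>a. keys a \<subseteq> xvars n \<longrightarrow> (\<Sum>b\<in>B0. u b * G a0 c0 (a + b)) = 0)
      \<longrightarrow> (\<forall>b\<in>B0. u b = 0)"
    using Suc.IH[OF g'_in \<open>g' a0 c0 \<noteq> 0\<close>] unfolding G_def[symmetric]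
    by (elim exE conjE) (rule that)
  obtain B1 where B1: "finite B1" "card B1 = 2 ^ n" "\<forall>b\<in>B1. keys b \<subseteq> yvars n"
    and ind1: "\<forall>u. (\<forall>a. keys a \<subseteq> xvars n \<longrightarrow> (\<Sum>b\<in>B1. u b * G a1 c1 (a + b)) = 0)
      \<longrightarrow> (\<forall>b\<in>B1. u b = 0)"
    using Suc.IH[OF g'_in \<open>g' a1 c1 \<noteq> 0\<close>] unfolding G_def[symmetric]
    by (elim exE conjE) (rule that)
  \<comment> \<open>The columns from \<open>B0\<close> go to \<open>?y\<close>-exponent
    \<open>c0\<close>, those from \<open>B1\<close> to \<open>Suc c1\<close>. The two exponents
    differ even if the end points coincide, because \<open>c0 \<le> c1\<close>.\<close>
  let ?s0 = "\<lambda>b. b + Poly_Mapping.single ?y c0" and ?s1 = "\<lambda>b. b + Poly_Mapping.single ?y (Suc c1)"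
  define B where "B = ?s0 ` B0 \<union> ?s1 ` B1"
  have y0: "lookup b ?y = 0" if "b \<in> B0 \<union> B1" for b
  proof -
    have "?y \<notin> yvars n"
      by (auto simp: yvars_def)
    then have "?y \<notin> keys b"
      using B0(3) B1(3) that by blast
    then show ?thesis
      by (simp add: in_keys_iff)
  qed
  have disj: "?s0 ` B0 \<inter> ?s1 ` B1 = {}"
  proof -
    have "?s0 b0 \<noteq> ?s1 b1" if "b0 \<in> B0" "b1 \<in> B1" for b0 b1
    proof
      assume "?s0 b0 = ?s1 b1"
      then have "lookup (?s0 b0) ?y = lookup (?s1 b1) ?y"
        by simp
      with K show False
        using that y0 by (simp add: lookup_add)
    qed
    then show ?thesis
      by auto
  qed
  have inj: "inj_on ?s0 B0" "inj_on ?s1 B1"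
    by (auto simp: inj_on_def)
  have "finite B"
    using B0 B1 by (simp add: B_def)
  moreover have "card B = 2 ^ Suc n"
    unfolding B_def using B0 B1 disj
    by (simp add: card_Un_disjoint card_image[OF inj(1)] card_image[OF inj(2)])
  moreover have "keys b \<subseteq> yvars (Suc n)" if "b \<in> B" for b
    using that B0(3) B1(3) by (fastforce simp: B_def keys_add_nat yvars_Suc split: if_splits)
  moreover have "\<forall>b\<in>B. u b = 0"
    if u: "\<And>a. keys a \<subseteq> xvars (Suc n) \<Longrightarrow> (\<Sum>b\<in>B. u b * lookup h (a + b)) = 0" for u
  proof -
    \<comment> \<open>This is the relation \<open>u\<close> read in the block row where
      \<open>?x\<close> has exponent \<open>k\<close>.\<close>
    have row: "(\<Sum>b\<in>B0. u (?s0 b) * H k c0 (a + b)) + (\<Sum>b\<in>B1. u (?s1 b) * H k (Suc c1) (a + b)) = 0"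
      if a: "keys a \<subseteq> xvars n" for a k
    proof -
      have "(\<Sum>b\<in>B. u b * lookup h (a + Poly_Mapping.single ?x k + b)) = 0"
        using a by (intro u) (auto simp: keys_add_nat xvars_Suc)
      then show ?thesis
        unfolding B_def using B0(1) B1(1) disj
        by (simp add: sum.union_disjoint sum.reindex[OF inj(1)] sum.reindex[OF inj(2)]
            H_def E_def ac_simps)
    qed
    have in_Z: "keys (a + b) \<subseteq> Z"
      if "keys a \<subseteq> xvars n" "b \<in> B0 \<union> B1" for a b
      using that B0(3) B1(3) by (auto simp: keys_add_nat Z_def)
    \<comment> \<open>Block row \<open>Suc a0\<close> has a zero block over \<open>B1\<close>, so it
      isolates the weights on \<open>B0\<close>. Once these vanish, block row \<open>a1\<close>
      isolates those on \<open>B1\<close>, whatever its block over \<open>B0\<close> is.\<close>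
    have u0: "u (?s0 b) = 0" if "b \<in> B0" for b
    proof (rule ind0[rule_format, OF _ that])
      fix a :: "xyvar \<Rightarrow>\<^sub>0 nat" assume "keys a \<subseteq> xvars n"
      with row[of a "Suc a0"] in_Z show "(\<Sum>b\<in>B0. u (?s0 b) * G a0 c0 (a + b)) = 0"
        by (simp add: H00 H01)
    qed
    have u1: "u (?s1 b) = 0" if "b \<in> B1" for b
    proof (rule ind1[rule_format, OF _ that])
      fix a :: "xyvar \<Rightarrow>\<^sub>0 nat" assume "keys a \<subseteq> xvars n"
      with row[of a a1] in_Z u0 show "(\<Sum>b\<in>B1. u (?s1 b) * G a1 c1 (a + b)) = 0"
        by (simp add: H11)
    qed
    show ?thesis
      using u0 u1 by (auto simp: B_def)
  qed
  ultimately show ?case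
    unfolding h_def by (intro exI[of _ B]) blast
qed

section \<open>From independent columns to the dimension\<close>

lemma lookup_scale_mpoly: "lookup (scale_mpoly c p) m = c * lookup p m"
proof -
  have "scale_mpoly c p = p * Poly_Mapping.single 0 c"
    by (simp add: scale_mpoly_def const_mpoly_def mult.commute)
  then show ?thesis
    using lookup_mult_keys[of p "Poly_Mapping.single 0 c" m]
    by (cases "c = 0") (auto simp: when_def sum.delta in_keys_iff mult.commute)
qed

text \<open>Exponents outside the support all give the coefficient 0. Finiteness is needed to
  compare an independent family with a basis taken from \<open>Coeff A B h\<close>.\<close>

lemma finite_Coeff: "finite (Coeff A B h)"
proof -
  have "Coeff A B h \<subseteq> insert 0 (coeff_xy A B h ` restrict_exp B ` keys h)"
  proof
    fix p assume "p \<in> Coeff A B h"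
    then obtain b where b: "p = coeff_xy A B h b"
      by (auto simp: Coeff_def)
    show "p \<in> insert 0 (coeff_xy A B h ` restrict_exp B ` keys h)"
    proof (cases "b \<in> restrict_exp B ` keys h")
      case False
      then have "{m \<in> keys h. restrict_exp B m = b} = {}"
        by auto
      then have "p = 0"
        unfolding b coeff_xy_def by (simp only: sum.empty)
      then show ?thesis by simp
    qed (simp add: b)
  qed
  then show ?thesis
    by (rule finite_subset) auto
qed

text \<open>Reading a vanishing combination of coefficient polynomials at each monomial
  \<open>a\<close> gives the row relations of \<open>ind\<close>. So these polynomials are
  independent and number at most the size of a basis.\<close>

lemma card_le_dim_Coeff:
  fixes h :: "('v, 'a::field) mpoly"
  assumes AB: "A \<inter> B = {}" and h: "h \<in> polys_in (A \<union> B)" and "finite S"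
    and S: "\<And>b. b \<in> S \<Longrightarrow> keys b \<subseteq> B"
    and ind: "\<And>u b. (\<And>a. keys a \<subseteq> A \<Longrightarrow> (\<Sum>b\<in>S. u b * lookup h (a + b)) = 0)
      \<Longrightarrow> b \<in> S \<Longrightarrow> u b = 0"
  shows "card S \<le> vector_space.dim scale_mpoly (Coeff A B h)"
proof -
  interpret vector_space "scale_mpoly :: 'a \<Rightarrow> ('v, 'a) mpoly \<Rightarrow> _"
    by (rule vector_space_mpoly)
  let ?c = "coeff_xy A B h"
  have zero: "u b = 0" if sum0: "(\<Sum>b\<in>S. scale_mpoly (u b) (?c b)) = 0" and "b \<in> S" for u b
  proof (rule ind[OF _ \<open>b \<in> S\<close>])
    fix a :: "'v \<Rightarrow>\<^sub>0 nat" assume a: "keys a \<subseteq> A"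
    have "(\<Sum>b\<in>S. u b * lookup h (a + b)) = lookup (\<Sum>b\<in>S. scale_mpoly (u b) (?c b)) a"
      by (simp add: lookup_sum lookup_scale_mpoly lookup_coeff_xy[OF AB h a S])
    then show "(\<Sum>b\<in>S. u b * lookup h (a + b)) = 0"
      by (simp add: sum0)
  qed
  have inj: "inj_on ?c S"
  proof
    fix b b' assume b: "b \<in> S" "b' \<in> S" "?c b = ?c b'"
    show "b = b'"
    proof (rule ccontr)
      assume "b \<noteq> b'"
      \<comment> \<open>Two equal columns would satisfy a relation with weights 1 and -1.\<close>
      define u :: "_ \<Rightarrow> 'a" where "u d = (if d = b then 1 else if d = b' then - 1 else 0)" for d
      have "(\<Sum>d\<in>S. scale_mpoly (u d) (?c d)) = (\<Sum>d\<in>{b, b'}. scale_mpoly (u d) (?c d))"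
        using b \<open>finite S\<close> by (intro sum.mono_neutral_right) (auto simp: u_def)
      also have "\<dots> = 0"
        using b \<open>b \<noteq> b'\<close> by (simp add: u_def)
      finally have "u b = 0"
        using zero b by blast
      then show False
        by (simp add: u_def)
    qed
  qed
  have "independent (?c ` S)"
  proof (rule independent_if_scalars_zero)
    fix u p assume "(\<Sum>p\<in>?c ` S. scale_mpoly (u p) p) = 0" "p \<in> ?c ` S"
    then show "u p = 0"
      using zero[of "u \<circ> ?c"] by (auto simp: sum.reindex[OF inj])
  qed (use \<open>finite S\<close> in auto)
  moreover obtain T where T: "T \<subseteq> Coeff A B h" "Coeff A B h \<subseteq> span T" "card T = dim (Coeff A B h)"
    using basis_exists by metis
  moreover have "?c ` S \<subseteq> Coeff A B h"
    using S by (auto simp: Coeff_def)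
  ultimately have "card (?c ` S) \<le> card T"
    using independent_span_bound[of T "?c ` S"] finite_subset[OF T(1) finite_Coeff] by blast
  then show ?thesis
    by (simp add: T card_image[OF inj])
qed

lemma dim_Coeff_mult_f_poly:
  fixes g :: "(xyvar, 'a::field) mpoly"
  assumes "g \<in> polys_in (xvars n \<union> yvars n)" "g \<noteq> 0"
  shows "2 ^ n \<le> vector_space.dim scale_mpoly (Coeff (xvars n) (yvars n) (g * f_poly n \<alpha>))"
proof -
  obtain B where B: "finite B" "card B = 2 ^ n" "\<And>b. b \<in> B \<Longrightarrow> keys b \<subseteq> yvars n"
    and ind: "\<And>u b. (\<And>a. keys a \<subseteq> xvars n \<Longrightarrow>
        (\<Sum>b\<in>B. u b * lookup (g * f_poly n \<alpha>) (a + b)) = 0) \<Longrightarrow> b \<in> B \<Longrightarrow> u b = 0"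
    using exists_independent_coeffs[OF assms, of \<alpha>] by metis
  have "card B \<le> vector_space.dim scale_mpoly (Coeff (xvars n) (yvars n) (g * f_poly n \<alpha>))"
  proof (rule card_le_dim_Coeff[OF xvars_yvars_disjoint _ B(1)])
    show "g * f_poly n \<alpha> \<in> polys_in (xvars n \<union> yvars n)"
      by (intro polys_in_mult assms f_poly_polys_in)
  next
    fix u :: "_ \<Rightarrow> 'a" and b
    assume "\<And>a. keys a \<subseteq> xvars n \<Longrightarrow>
        (\<Sum>b\<in>B. u b * lookup (g * f_poly n \<alpha>) (a + b)) = 0" "b \<in> B"
    then show "u b = 0"
      by (rule ind)
  qed (rule B(3))
  then show ?thesis
    by (simp add: B)
qed

section \<open>Cutting an roABP at a layer\<close>

text \<open>Each coefficient of the sum is a combination of the \<open>P i\<close>, with the scalar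
  coefficients of the \<open>Q i\<close> as weights, so all of them lie in the span of the
  \<open>P i\<close>.\<close>

lemma dim_Coeff_sum_products_le:
  fixes P Q :: "'u \<Rightarrow> ('v, 'a::field) mpoly"
  assumes AB: "A \<inter> B = {}" and "finite I"
    and P: "\<And>i. i \<in> I \<Longrightarrow> P i \<in> polys_in A" and Q: "\<And>i. i \<in> I \<Longrightarrow> Q i \<in> polys_in B"
  shows "vector_space.dim scale_mpoly (Coeff A B (\<Sum>i\<in>I. P i * Q i)) \<le> card I"
proof -
  interpret vector_space "scale_mpoly :: 'a \<Rightarrow> ('v, 'a) mpoly \<Rightarrow> _"
    by (rule vector_space_mpoly)
  let ?h = "\<Sum>i\<in>I. P i * Q i"
  have h: "?h \<in> polys_in (A \<union> B)"
    by (intro polys_in_sum polys_in_mult) (auto intro: polys_in_mono P Q)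
  have "coeff_xy A B ?h b = (\<Sum>i\<in>I. scale_mpoly (lookup (Q i) b) (P i))"
    if b: "keys b \<subseteq> B" for b
  proof (rule poly_mapping_eqI)
    fix a
    show "lookup (coeff_xy A B ?h b) a = lookup (\<Sum>i\<in>I. scale_mpoly (lookup (Q i) b) (P i)) a"
    proof (cases "keys a \<subseteq> A")
      case True
      then show ?thesis
        by (simp add: lookup_coeff_xy[OF AB h True b] lookup_sum lookup_scale_mpoly
            lookup_mult_disjoint[OF P Q AB True b] mult.commute)
    next
      case False
      then have "lookup (coeff_xy A B ?h b) a = 0"
        using coeff_xy_polys_in polys_inD by blast
      moreover have "lookup (P i) a = 0" if "i \<in> I" for i
        using False P[OF that] polys_inD by blast
      ultimately show ?thesis
        by (simp add: lookup_sum lookup_scale_mpoly)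
    qed
  qed
  then have "Coeff A B ?h \<subseteq> span (P ` I)"
    by (auto simp: Coeff_def intro!: span_sum span_scale span_base[OF imageI])
  then have "dim (Coeff A B ?h) \<le> card (P ` I)"
    using \<open>finite I\<close> by (intro dim_le_card) auto
  also have "\<dots> \<le> card I"
    using \<open>finite I\<close> by (rule card_image_le)
  finally show ?thesis .
qed

context roABP
begin

lemma layer_unique: "u \<in> V i \<Longrightarrow> u \<in> V j \<Longrightarrow> i \<le> length vs \<Longrightarrow> j \<le> length vs \<Longrightarrow> i = j"
  using layers_disjoint by blast

lemma finite_layer: "i \<le> length vs \<Longrightarrow> finite (V i)"
  using finite_verts verts_layers by (auto intro: finite_subset)

text \<open>Disjointness of the layers identifies the index given by \<open>arcs_layers\<close> with
  the layer of the tail.\<close>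

lemma arc_layer:
  assumes "e \<in> arcs G" "tail G e \<in> V i" "i \<le> length vs"
  shows "i < length vs" "head G e \<in> V (Suc i)" "lab e \<in> polys_in {vs ! i}"
  using arcs_layers[OF assms(1)] assms layer_unique by (metis less_imp_le)+

text \<open>Every arc moves one layer forward. The claims are proved together since distinctness of
  the vertices rests on their layers.\<close>

lemma awalk_layers:
  assumes "awalk u p v" "u \<in> V i" "i \<le> length vs"
  shows "i + length p \<le> length vs \<and> v \<in> V (i + length p) \<and>
    (\<Prod>e\<leftarrow>p. lab e) \<in> polys_in ((!) vs ` {i..<i + length p}) \<and>
    (\<forall>w\<in>set (awalk_verts u p). \<exists>j. i \<le> j \<and> j \<le> length vs \<and> w \<in> V j) \<and>
    distinct (awalk_verts u p)"
  using assms
proof (induction p arbitrary: u i)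
  case Nil
  then show ?case
    by (auto simp: awalk_Nil_iff polys_in_1)
next
  case (Cons e p)
  then have e: "e \<in> arcs G" "tail G e = u" and p: "awalk (head G e) p v"
    by (auto simp: awalk_Cons_iff)
  note layer = arc_layer[OF e(1), of i, unfolded e(2), OF Cons.prems(2,3)]
  note IH = Cons.IH[OF p layer(2)]
  \<comment> \<open>The vertex \<open>u\<close> is in layer \<open>i\<close>, while the remaining
    walk stays in layers from \<open>Suc i\<close> on.\<close>
  have "u \<notin> set (awalk_verts (head G e) p)"
    using IH layer(1) layer_unique[OF Cons.prems(2) _ Cons.prems(3)] by fastforce
  moreover have "(\<Prod>e\<leftarrow>e # p. lab e) \<in> polys_in ((!) vs ` {i..<i + length (e # p)})"
  proof -
    have "lab e \<in> polys_in ((!) vs ` {i..<i + length (e # p)})"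
      using layer(3) by (rule polys_in_mono) auto
    moreover have "(\<Prod>e\<leftarrow>p. lab e) \<in> polys_in ((!) vs ` {i..<i + length (e # p)})"
      using IH layer(1) by (auto elim!: polys_in_mono)
    ultimately show ?thesis
      by (simp add: polys_in_mult)
  qed
  moreover have "\<exists>j. i \<le> j \<and> j \<le> length vs \<and> w \<in> V j" if "w \<in> set (awalk_verts u (e # p))" for w
    using that e IH layer(1) Cons.prems by (auto dest: Suc_leD)
  ultimately show ?case
    using IH layer(1) e by auto
qed

lemma apath_layers:
  assumes "apath u p v" "u \<in> V i" "v \<in> V j" "i \<le> length vs" "j \<le> length vs"
  shows "j = i + length p" "(\<Prod>e\<leftarrow>p. lab e) \<in> polys_in ((!) vs ` {i..<j})"
proof -
  note * = awalk_layers[OF awalkI_apath[OF assms(1)] assms(2,4)]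
  show "j = i + length p"
    using * layer_unique[OF assms(3)] assms(5) by blast
  with * show "(\<Prod>e\<leftarrow>p. lab e) \<in> polys_in ((!) vs ` {i..<j})"
    by simp
qed

text \<open>Walks can be split and joined freely, paths cannot in general; in a layered graph the
  two notions agree.\<close>

lemma apath_iff_awalk: "u \<in> V i \<Longrightarrow> i \<le> length vs \<Longrightarrow> apath u p v \<longleftrightarrow> awalk u p v"
  using awalk_layers by (auto simp: apath_def)

lemma abp_poly_polys_in:
  assumes "u \<in> V i" "v \<in> V j" "i \<le> length vs" "j \<le> length vs"
  shows "abp_poly G u v lab \<in> polys_in ((!) vs ` {i..<j})"
  unfolding abp_poly_def using apath_layers(2) assms by (intro polys_in_sum) blast

text \<open>A path from \<open>s\<close> to \<open>t\<close> is in layer \<open>k\<close> exactly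
  after its first \<open>k\<close> arcs. Cutting there is a bijection onto pairs of paths that meet
  in that layer.\<close>

lemma abp_poly_cut:
  assumes "k \<le> length vs"
  shows "abp_poly G s t lab = (\<Sum>v\<in>V k. abp_poly G s v lab * abp_poly G v t lab)"
proof -
  have s: "s \<in> V 0" and t: "t \<in> V (length vs)"
    using source sink by auto
  let ?S = "SIGMA v:V k. {p. apath s p v} \<times> {q. apath v q t}"
  have "(\<Sum>v\<in>V k. abp_poly G s v lab * abp_poly G v t lab) =
      (\<Sum>v\<in>V k. \<Sum>(p, q)\<in>{p. apath s p v} \<times> {q. apath v q t}. (\<Prod>e\<leftarrow>p. lab e) * (\<Prod>e\<leftarrow>q. lab e))"
    by (simp add: abp_poly_def sum_product sum.cartesian_product)
  also have "\<dots> = (\<Sum>(v, p, q)\<in>?S. (\<Prod>e\<leftarrow>p. lab e) * (\<Prod>e\<leftarrow>q. lab e))"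
    by (subst sum.Sigma) (auto simp: finite_layer[OF assms] apaths_finite)
  also have "\<dots> = (\<Sum>p\<in>{p. apath s p t}. \<Prod>e\<leftarrow>p. lab e)"
  proof (rule sum.reindex_bij_witness[where
        i = "\<lambda>p. (awlast s (take k p), take k p, drop k p)" and j = "\<lambda>(v, p, q). p @ q"])
    fix vpq assume "vpq \<in> ?S"
    then obtain v p q where vpq: "vpq = (v, p, q)" "v \<in> V k" "apath s p v" "apath v q t"
      by auto
    \<comment> \<open>The first part has exactly \<open>k\<close> arcs, so \<open>take k\<close> and
      \<open>drop k\<close> recover both parts from the concatenation.\<close>
    have "length p = k"
      using apath_layers(1)[OF vpq(3) s vpq(2)] assms by simp
    moreover have pq: "awalk s p v" "awalk v q t" "awlast s p = v"
      using vpq by (auto simp: apath_def)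
    ultimately show "(\<lambda>p. (awlast s (take k p), take k p, drop k p)) ((\<lambda>(v, p, q). p @ q) vpq) = vpq"
      using vpq by simp
    show "(\<lambda>(v, p, q). p @ q) vpq \<in> {p. apath s p t}"
      using pq apath_iff_awalk[OF s] vpq by simp
    show "(\<Prod>e\<leftarrow>(\<lambda>(v, p, q). p @ q) vpq. lab e) =
        (case vpq of (v, p, q) \<Rightarrow> (\<Prod>e\<leftarrow>p. lab e) * (\<Prod>e\<leftarrow>q. lab e))"
      using vpq by simp
  next
    fix p assume "p \<in> {p. apath s p t}"
    then have p: "apath s p t" by simp
    then have len: "length p = length vs"
      using apath_layers(1)[OF p s t] by simp
    let ?v = "awlast s (take k p)"
    have *: "awalk s (take k p) ?v" "awalk ?v (drop k p) t"
      using awalkI_apath[OF p] awalk_append_iff[of s "take k p" "drop k p" t] by simp_all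
    then have v: "?v \<in> V k"
      using awalk_layers[OF *(1) s] len assms by (simp add: min_absorb2)
    show "(?v, take k p, drop k p) \<in> ?S"
      using * v apath_iff_awalk[OF s] apath_iff_awalk[OF v assms] by simp
    show "(\<lambda>(v, p, q). p @ q) (?v, take k p, drop k p) = p"
      by simp
  qed
  finally show ?thesis
    by (simp add: abp_poly_def)
qed

end

section \<open>The width bound for orders with x before y\<close>

lemma precedes_cut:
  assumes "precedes vs A B" "set vs \<subseteq> A \<union> B"
  obtains k where "k \<le> length vs" "(!) vs ` {0..<k} \<subseteq> A" "(!) vs ` {k..<length vs} \<subseteq> B"
proof (cases "\<exists>i<length vs. vs ! i \<notin> A")
  case True
  \<comment> \<open>The cut is at the first variable outside \<open>A\<close>. That variable lies in
    \<open>B\<close>, so by \<open>precedes\<close> no variable of \<open>A\<close> can occur from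
    there on.\<close>
  define k where "k = (LEAST i. i < length vs \<and> vs ! i \<notin> A)"
  have k: "k < length vs" "vs ! k \<notin> A"
    unfolding k_def using LeastI_ex[OF True] by auto
  have "vs ! i \<in> A" if "i < k" for i
    using not_less_Least[of i "\<lambda>i. i < length vs \<and> vs ! i \<notin> A"] that k unfolding k_def by auto
  moreover have "vs ! k \<in> B"
    using k assms(2) nth_mem by blast
  then have "vs ! i \<notin> A" if "k \<le> i" "i < length vs" for i
    using assms(1) k that unfolding precedes_def by (meson leD)
  then have "vs ! i \<in> B" if "k \<le> i" "i < length vs" for i
    using that assms(2) nth_mem by blast
  ultimately show thesis
    using k by (intro that[of k]) auto
next
  case False
  then show thesis
    by (intro that[of "length vs"]) auto
qed

text \<open>Cutting at the layer between the variables of \<open>A\<close> and those of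
  \<open>B\<close> gives one product per vertex of that layer, hence at most \<open>r\<close>
  products.\<close>

lemma dim_Coeff_abp_poly_le:
  fixes lab :: "'e \<Rightarrow> ('v, 'a::field) mpoly"
  assumes "roABP G vs V s t lab r" and AB: "A \<inter> B = {}" and "set vs \<subseteq> A \<union> B" "precedes vs A B"
  shows "vector_space.dim scale_mpoly (Coeff A B (abp_poly G s t lab)) \<le> r"
proof -
  interpret roABP G vs V s t lab r
    by fact
  obtain k where k: "k \<le> length vs" "(!) vs ` {0..<k} \<subseteq> A" "(!) vs ` {k..<length vs} \<subseteq> B"
    using precedes_cut assms by metis
  have "vector_space.dim scale_mpoly (Coeff A B (abp_poly G s t lab)) \<le> card (V k)"
    unfolding abp_poly_cut[OF k(1)]
  proof (rule dim_Coeff_sum_products_le[OF AB finite_layer[OF k(1)]])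
    fix v assume "v \<in> V k"
    then show "abp_poly G s v lab \<in> polys_in A" "abp_poly G v t lab \<in> polys_in B"
      using abp_poly_polys_in[of s 0 v k] abp_poly_polys_in[of v k t "length vs"] k source sink
      by (auto elim!: polys_in_mono)
  qed
  also have "\<dots> \<le> r"
    using k(1) by (rule width)
  finally show ?thesis .
qed

theorem proposition6p21:
  fixes n :: nat and \<alpha> :: "nat \<Rightarrow> 'a::field"
  shows "(\<forall>g \<in> polys_in (xvars n \<union> yvars n). g \<noteq> 0 \<longrightarrow>
           2 ^ n \<le> vector_space.dim scale_mpoly (Coeff (xvars n) (yvars n) (g * f_poly n \<alpha>))) \<and>
         (\<forall>h g. g \<in> polys_in (xvars n \<union> yvars n) \<and> h = g * f_poly n \<alpha> \<and> h \<noteq> 0 \<longrightarrow>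
           (\<forall>vs (G :: ('u, 'e) pre_digraph) V s t lab r.
              set vs = xvars n \<union> yvars n \<and> precedes vs (xvars n) (yvars n) \<and>
              roABP G vs V s t lab r \<and> abp_poly G s t lab = h \<longrightarrow> 2 ^ n \<le> r))"
proof (intro conjI ballI allI impI; (elim conjE)?)
  fix g :: "(xyvar, 'a) mpoly"
  assume "g \<in> polys_in (xvars n \<union> yvars n)" "g \<noteq> 0"
  then show "2 ^ n \<le> vector_space.dim scale_mpoly (Coeff (xvars n) (yvars n) (g * f_poly n \<alpha>))"
    by (rule dim_Coeff_mult_f_poly)
next
  fix h g :: "(xyvar, 'a) mpoly" and vs and G :: "('u, 'e) pre_digraph" and V s t lab r
  assume g: "g \<in> polys_in (xvars n \<union> yvars n)" and h: "h = g * f_poly n \<alpha>" "h \<noteq> 0"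
    and vs: "set vs = xvars n \<union> yvars n" "precedes vs (xvars n) (yvars n)"
    and G: "roABP G vs V s t lab r" "abp_poly G s t lab = h"
  \<comment> \<open>A nonzero multiple \<open>h\<close> has a nonzero cofactor \<open>g\<close>, so
    the dimension bound applies.\<close>
  have "2 ^ n \<le> vector_space.dim scale_mpoly (Coeff (xvars n) (yvars n) h)"
    unfolding h(1) using g h by (intro dim_Coeff_mult_f_poly) auto
  also have "\<dots> \<le> r"
    unfolding G(2)[symmetric] using vs
    by (intro dim_Coeff_abp_poly_le[OF G(1) xvars_yvars_disjoint]) auto
  finally show "2 ^ n \<le> r" .
qed

end
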